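(* Let $(f,x,q,d)\in K_1$ and $h=(h_s)_{s\in D}\in K_2$. Then $h$ is a solution of the parametric variational inequality $$\sum_{s\in D}(\tilde h_s-h_s)\left[\tfrac1\beta\ln h_s-B_s(d_s,h_s)\right]\ge0\quad\text{for all }\tilde h\in K_2$$ if and only if $h$ is a parametric business competitive location equilibrium for the parameter $(f,x,q,d)$, i.e. if and only if $$h_s=T\,\frac{\exp[\beta B_s(d_s,h_s)]}{\sum_{j\in D}\exp[\beta B_j(d_j,h_j)]}\quad\text{for all }s\in D.$$
   Context: $G=(V,A)$ is a finite directed network with link set $A$, finite nonempty origin set $O$ and destination set $D$ (every destination is a business center). For $r\in O$, $s\in D$, $R_{rs}$ is the (finite, nonempty) set of simple routes from $r$ to $s$; $\delta_{ak}^{rs}=1$ if link $a$ lies on route $k\in R_{rs}$ and $0$ otherwise. $O_r>0$ is the fixed travel demand from origin $r$, and $T>0$ is the fixed total number of business companies. Variables: path flows $f=(f_k^{rs})$, link flows $x=(x_a)$, origin-destination demands $q=(q_{rs})$, destination demands $d=(d_s)$, business flows $h=(h_s)$. $$K_1=\Big\{(f,x,q,d): f_k^{rs}\ge0,\ \sum_{k\in R_{rs}}f_k^{rs}=q_{rs},\ \sum_{s\in D}q_{rs}=O_r,\ \sum_{r\in O}\sum_{s\in D}\sum_{k\in R_{rs}}\delta_{ak}^{rs}f_k^{rs}=x_a,\ \sum_{r\in O}q_{rs}=d_s\ \ \forall k\in R_{rs},r\in O,s\in D,a\in A\Big\},$$ $$K_2=\Big\{h: h_s\ge0\ \forall s\in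 D,\ \sum_{s\in D}h_s=T\Big\}.$$ Parameter: $\beta>0$. Standing assumption on functions of nonnegative real arguments: each business attraction function $B_s(d_s,h_s)$ is continuously differentiable, strictly increasing in $d_s$ and strictly decreasing in $h_s$. Convention: since the variational inequality contains $\ln h_s$ evaluated at the candidate solution, a solution is understood to have all components $h_s>0$. *)

theory Defs
  imports "HOL-Analysis.Analysis" "Graph_Theory.Digraph" "Graph_Theory.Arc_Walk"
begin

text \<open>Vertices have type \<open>'v\<close>, links have type \<open>'a\<close>; parallel links are allowed, so a route is a
  list of links. All flows and demands are total functions that are constrained only at origins,
  destinations, routes and links of the network; their other values are irrelevant.\<close>

definition routes :: "('v, 'a) pre_digraph \<Rightarrow> 'v \<Rightarrow> 'v \<Rightarrow> 'a list set" where
  "routes G r s = {k. pre_digraph.apath G r k s}"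

definition incidence :: "'a \<Rightarrow> 'a list \<Rightarrow> real" where
  "incidence a k = (if a \<in> set k then 1 else 0)"

lemma (in fin_digraph) finite_routes: "finite (routes G r s)"
  by (simp add: routes_def apaths_finite)

type_synonym ('v, 'a) traffic_state =
  "('v \<Rightarrow> 'v \<Rightarrow> 'a list \<Rightarrow> real) \<times> ('a \<Rightarrow> real) \<times> ('v \<Rightarrow> 'v \<Rightarrow> real) \<times> ('v \<Rightarrow> real)"

definition K1 ::
  "('v, 'a) pre_digraph \<Rightarrow> 'v set \<Rightarrow> 'v set \<Rightarrow> ('v \<Rightarrow> real) \<Rightarrow> ('v, 'a) traffic_state set" where
  "K1 G Or De dem = {(f, x, q, d).
     (\<forall>r\<in>Or. \<forall>s\<in>De. \<forall>k\<in>routes G r s. f r s k \<ge> 0) \<and>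
     (\<forall>r\<in>Or. \<forall>s\<in>De. (\<Sum>k\<in>routes G r s. f r s k) = q r s) \<and>
     (\<forall>r\<in>Or. (\<Sum>s\<in>De. q r s) = dem r) \<and>
     (\<forall>a\<in>arcs G. (\<Sum>r\<in>Or. \<Sum>s\<in>De. \<Sum>k\<in>routes G r s. incidence a k * f r s k) = x a) \<and>
     (\<forall>s\<in>De. (\<Sum>r\<in>Or. q r s) = d s)}"

definition K2 :: "'v set \<Rightarrow> real \<Rightarrow> ('v \<Rightarrow> real) set" where
  "K2 De T = {h. (\<forall>s\<in>De. h s \<ge> 0) \<and> (\<Sum>s\<in>De. h s) = T}"

text \<open>Continuous differentiability on a set that need not be open: the derivative is taken
  relative to the set (one-sided at the boundary of the quadrant used below).\<close>

definition continuously_differentiable_on ::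
  "('b::real_normed_vector \<Rightarrow> 'c::real_normed_vector) \<Rightarrow> 'b set \<Rightarrow> bool" where
  "continuously_differentiable_on g S \<longleftrightarrow>
     (\<exists>g' :: 'b \<Rightarrow> 'b \<Rightarrow>\<^sub>L 'c. (\<forall>z\<in>S. (g has_derivative blinfun_apply (g' z)) (at z within S)) \<and>
           continuous_on S g')"

text \<open>The first argument is the destination demand, the second the business flow.\<close>

definition attraction_function :: "(real \<Rightarrow> real \<Rightarrow> real) \<Rightarrow> bool" where
  "attraction_function b \<longleftrightarrow>
     continuously_differentiable_on (\<lambda>(u, v). b u v) ({0..} \<times> {0..}) \<and>
     (\<forall>v\<ge>0. strict_mono_on {0..} (\<lambda>u. b u v)) \<and>
     (\<forall>u\<ge>0. strict_antimono_on {0..} (\<lambda>v. b u v))"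

text \<open>Positivity of \<open>h\<close> is part of being a solution, because \<open>ln\<close> is evaluated at \<open>h\<close>
  (and the library totalises \<open>ln\<close> outside the positive reals). The test points range over
  all of \<open>K2\<close>.\<close>

fun parametric_VI_solution ::
  "'v set \<Rightarrow> real \<Rightarrow> real \<Rightarrow> ('v \<Rightarrow> real \<Rightarrow> real \<Rightarrow> real) \<Rightarrow> ('v, 'a) traffic_state \<Rightarrow>
     ('v \<Rightarrow> real) \<Rightarrow> bool" where
  "parametric_VI_solution De T \<beta> B (f, x, q, d) h \<longleftrightarrow>
     h \<in> K2 De T \<and> (\<forall>s\<in>De. h s > 0) \<and>
     (\<forall>h'\<in>K2 De T. (\<Sum>s\<in>De. (h' s - h s) * (1 / \<beta> * ln (h s) - B s (d s) (h s))) \<ge> 0)"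

fun parametric_location_equilibrium ::
  "'v set \<Rightarrow> real \<Rightarrow> real \<Rightarrow> ('v \<Rightarrow> real \<Rightarrow> real \<Rightarrow> real) \<Rightarrow> ('v, 'a) traffic_state \<Rightarrow>
     ('v \<Rightarrow> real) \<Rightarrow> bool" where
  "parametric_location_equilibrium De T \<beta> B (f, x, q, d) h \<longleftrightarrow>
     (\<forall>s\<in>De. h s = T * (exp (\<beta> * B s (d s) (h s)) / (\<Sum>j\<in>De. exp (\<beta> * B j (d j) (h j)))))"

end

theory Submission
  imports Defs
begin

text \<open>Over the simplex of business flows, a linear functional is minimised at a point with all
  components positive exactly when its coefficients agree: otherwise shifting all the flow from a
  dearer component to a cheaper one lowers it (lemma \<open>interior_VI_iff_constant_cost\<close>).
  The variational inequality, whose solutions are positive by convention, therefore says that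
  \<open>ln h\<^sub>s / \<beta> - B\<^sub>s\<close> does not depend on \<open>s\<close>. Exponentiating, this means that \<open>h\<^sub>s\<close> is
  proportional to \<open>exp (\<beta> B\<^sub>s)\<close>, and the total \<open>T\<close> fixes the factor of proportionality, which
  gives the logit formula (lemma \<open>constant_cost_iff_logit\<close>). Conversely the logit formula
  already forces positivity, since \<open>T\<close> and all exponentials are positive.

  The demands \<open>d\<close> are parameters, and \<open>h\<close> enters the attraction only through the values
  \<open>B\<^sub>s (d\<^sub>s, h\<^sub>s)\<close> at the candidate solution, so both lemmas treat these values as fixed numbers.\<close>

text \<open>Positivity of \<open>h\<close> is what makes every transfer of flow between two components a feasible
  test direction. At the boundary only components with positive flow can give some away, and the
  coefficients of the empty ones need not be minimal.\<close>

lemma interior_VI_iff_constant_cost: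
  fixes c h :: "'v \<Rightarrow> real"
  assumes fin: "finite S" and h: "h \<in> K2 S T" and pos: "\<And>s. s \<in> S \<Longrightarrow> h s > 0"
  shows "(\<forall>h'\<in>K2 S T. (\<Sum>s\<in>S. (h' s - h s) * c s) \<ge> 0) \<longleftrightarrow> (\<forall>s\<in>S. \<forall>t\<in>S. c s = c t)"
proof
  assume VI: "\<forall>h'\<in>K2 S T. (\<Sum>s\<in>S. (h' s - h s) * c s) \<ge> 0"
  have le: "c s \<le> c t" if s: "s \<in> S" and t: "t \<in> S" for s t
  proof (cases "s = t")
    case False
    \<comment> \<open>The test point moves all the flow at \<open>s\<close> to \<open>t\<close>.\<close>
    define h' where "h' = (\<lambda>r. h r + (if r = t then h s else 0) - (if r = s then h s else 0))"
    have "(\<Sum>r\<in>S. h' r) = (\<Sum>r\<in>S. h r)"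
      using fin s t by (simp add: h'_def sum.distrib sum_subtractf)
    moreover have "h' r \<ge> 0" if "r \<in> S" for r
      using pos[OF that] pos[OF s] False by (auto simp: h'_def)
    ultimately have "h' \<in> K2 S T"
      using h by (simp add: K2_def)
    then have "0 \<le> (\<Sum>r\<in>S. (h' r - h r) * c r)"
      using VI by blast
    also have "\<dots> = (\<Sum>r\<in>S. (if r = t then h s * c r else 0) - (if r = s then h s * c r else 0))"
      by (intro sum.cong) (auto simp: h'_def algebra_simps)
    also have "\<dots> = h s * (c t - c s)"
      using fin s t by (simp add: sum_subtractf right_diff_distrib)
    finally show ?thesis
      using pos[OF s] by (simp add: zero_le_mult_iff)
  qed simp
  then show "\<forall>s\<in>S. \<forall>t\<in>S. c s = c t"
    by (meson order_antisym)
next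
  assume const: "\<forall>s\<in>S. \<forall>t\<in>S. c s = c t"
  show "\<forall>h'\<in>K2 S T. (\<Sum>s\<in>S. (h' s - h s) * c s) \<ge> 0"
  proof
    fix h' assume h': "h' \<in> K2 S T"
    obtain C where "\<forall>s\<in>S. c s = C"
      using const by metis
    then have "(\<Sum>s\<in>S. (h' s - h s) * c s) = (\<Sum>s\<in>S. h' s - h s) * C"
      by (simp add: sum_distrib_right)
    also have "\<dots> = 0"
      using h h' by (simp add: K2_def sum_subtractf)
    finally show "(\<Sum>s\<in>S. (h' s - h s) * c s) \<ge> 0"
      by simp
  qed
qed

text \<open>If the common value is \<open>C\<close>, then \<open>h s = exp (\<beta> * C) * exp (\<beta> * b s)\<close>, and summing over \<open>s\<close>
  gives \<open>exp (\<beta> * C) = T / Z\<close> with \<open>Z\<close> the sum of the exponentials. Conversely, the logarithm of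
  the logit formula exhibits the common value \<open>ln (T / Z) / \<beta>\<close>.\<close>

lemma constant_cost_iff_logit:
  fixes b h :: "'v \<Rightarrow> real"
  assumes fin: "finite S" and beta: "\<beta> > 0"
    and pos: "\<And>s. s \<in> S \<Longrightarrow> h s > 0" and total: "(\<Sum>s\<in>S. h s) = T"
  shows "(\<forall>s\<in>S. \<forall>t\<in>S. 1 / \<beta> * ln (h s) - b s = 1 / \<beta> * ln (h t) - b t) \<longleftrightarrow>
         (\<forall>s\<in>S. h s = T * (exp (\<beta> * b s) / (\<Sum>j\<in>S. exp (\<beta> * b j))))"
proof
  assume const: "\<forall>s\<in>S. \<forall>t\<in>S. 1 / \<beta> * ln (h s) - b s = 1 / \<beta> * ln (h t) - b t"
  show "\<forall>s\<in>S. h s = T * (exp (\<beta> * b s) / (\<Sum>j\<in>S. exp (\<beta> * b j)))"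
  proof
    fix s assume s: "s \<in> S"
    define C where "C = 1 / \<beta> * ln (h s) - b s"
    have proportional: "h t = exp (\<beta> * C) * exp (\<beta> * b t)" if t: "t \<in> S" for t
    proof -
      have "1 / \<beta> * ln (h t) - b t = C"
        unfolding C_def using const s t by blast
      then have "ln (h t) = \<beta> * C + \<beta> * b t"
        using beta by (simp add: field_simps)
      then show ?thesis
        using pos[OF t] by (metis exp_add exp_ln)
    qed
    have "T = exp (\<beta> * C) * (\<Sum>j\<in>S. exp (\<beta> * b j))"
      unfolding total[symmetric] sum_distrib_left by (intro sum.cong refl proportional)
    moreover have "(\<Sum>j\<in>S. exp (\<beta> * b j)) > 0"
      using fin s by (intro sum_pos) auto
    ultimately show "h s = T * (exp (\<beta> * b s) / (\<Sum>j\<in>S. exp (\<beta> * b j)))"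
      using proportional[OF s] by simp
  qed
next
  define Z where "Z = (\<Sum>j\<in>S. exp (\<beta> * b j))"
  assume "\<forall>s\<in>S. h s = T * (exp (\<beta> * b s) / (\<Sum>j\<in>S. exp (\<beta> * b j)))"
  then have logit: "h s = T / Z * exp (\<beta> * b s)" if "s \<in> S" for s
    using that by (simp add: Z_def)
  have "1 / \<beta> * ln (h s) - b s = 1 / \<beta> * ln (T / Z)" if s: "s \<in> S" for s
  proof -
    have "T / Z > 0"
      using pos[OF s] unfolding logit[OF s] by (rule zero_less_mult_pos2) simp
    then have "ln (h s) = ln (T / Z) + \<beta> * b s"
      unfolding logit[OF s] by (subst ln_mult_pos) auto
    then show ?thesis
      using beta by (simp add: field_simps)
  qed
  then show "\<forall>s\<in>S. \<forall>t\<in>S. 1 / \<beta> * ln (h s) - b s = 1 / \<beta> * ln (h t) - b t"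
    by simp
qed

theorem theorem2:
  fixes G :: "('v, 'a) pre_digraph"
    and Or De :: "'v set"
    and dem :: "'v \<Rightarrow> real"
    and T \<beta> :: real
    and B :: "'v \<Rightarrow> real \<Rightarrow> real \<Rightarrow> real"
    and f :: "'v \<Rightarrow> 'v \<Rightarrow> 'a list \<Rightarrow> real"
    and x :: "'a \<Rightarrow> real"
    and q :: "'v \<Rightarrow> 'v \<Rightarrow> real"
    and d h :: "'v \<Rightarrow> real"
  assumes "fin_digraph G"
    and "Or \<subseteq> verts G" and "Or \<noteq> {}"
    and "De \<subseteq> verts G" and "De \<noteq> {}"
    and "\<And>r s. r \<in> Or \<Longrightarrow> s \<in> De \<Longrightarrow> routes G r s \<noteq> {}"
    and "\<And>r. r \<in> Or \<Longrightarrow> dem r > 0"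
    and "T > 0" and "\<beta> > 0"
    and "\<And>s. s \<in> De \<Longrightarrow> attraction_function (B s)"
    and "(f, x, q, d) \<in> K1 G Or De dem"
    and "h \<in> K2 De T"
  shows "parametric_VI_solution De T \<beta> B (f, x, q, d) h \<longleftrightarrow>
         parametric_location_equilibrium De T \<beta> B (f, x, q, d) h"
proof -
  have fin: "finite De"
    using assms(1,4) finite_subset fin_digraph.finite_verts by blast
  have total: "(\<Sum>s\<in>De. h s) = T"
    using assms(12) by (simp add: K2_def)
  show ?thesis
  proof (cases "\<forall>s\<in>De. h s > 0")
    case True
    have "parametric_VI_solution De T \<beta> B (f, x, q, d) h \<longleftrightarrow>
        (\<forall>h'\<in>K2 De T. (\<Sum>s\<in>De. (h' s - h s) * (1 / \<beta> * ln (h s) - B s (d s) (h s))) \<ge> 0)"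
      unfolding parametric_VI_solution.simps using True assms(12) by blast
    also have "\<dots> \<longleftrightarrow> (\<forall>s\<in>De. \<forall>t\<in>De. 1 / \<beta> * ln (h s) - B s (d s) (h s)
                                          = 1 / \<beta> * ln (h t) - B t (d t) (h t))"
      by (rule interior_VI_iff_constant_cost[OF fin assms(12)]) (use True in blast)
    also have "\<dots> \<longleftrightarrow> parametric_location_equilibrium De T \<beta> B (f, x, q, d) h"
      unfolding parametric_location_equilibrium.simps
      by (rule constant_cost_iff_logit[OF fin assms(9) _ total]) (use True in blast)
    finally show ?thesis .
  next
    case False
    \<comment> \<open>The logit shares are positive, so both sides of the equivalence fail.\<close>
    have "(\<Sum>j\<in>De. exp (\<beta> * B j (d j) (h j))) > 0"
      using fin assms(5) by (intro sum_pos) auto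
    then have "T * (exp (\<beta> * B s (d s) (h s)) / (\<Sum>j\<in>De. exp (\<beta> * B j (d j) (h j)))) > 0" for s
      using assms(8) by simp
    moreover obtain s where "s \<in> De" "\<not> h s > 0"
      using False by blast
    ultimately have "\<not> parametric_location_equilibrium De T \<beta> B (f, x, q, d) h"
      unfolding parametric_location_equilibrium.simps by metis
    then show ?thesis
      using False unfolding parametric_VI_solution.simps by blast
  qed
qed

end
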